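(* Let $K$ be a field, let $Q$ be a finite quiver with $n$ vertices $v_1,\dots,v_n$, let $I$ be a two-sided ideal of $KQ$ contained in the ideal generated by the paths of length $2$, let $\Lambda=KQ/I$, let $\mathcal{B}$ be the set of finite paths in $Q$, and let $f\colon\mathcal{B}\to K^*$ be a set map. Let $C^f\subseteq\Lambda$ be the quasi-commuting ideal of $\Lambda$ and $f$. Then: (1) $\dim_K\bigl(v_i(\Lambda/C^f)v_j\bigr)\le 1$ for all $1\le i,j\le n$. (2) Every quasi-commuting algebra $\Lambda/C^f$ of $\Lambda$ is finite dimensional, with dimension over $K$ no greater than $n^2$.
   Context: $K^*=K\setminus\{0\}$. $\mathcal{B}$ is the set of all finite paths in $Q$, including the paths of length zero (the vertices). Paths are composed from left to right: a path $p$ from $v$ to $w$ satisfies $vp=p=pw$ in the path algebra $KQ$. Two paths $p,q\in\mathcal{B}$ are parallel, written $p\|q$, if there are vertices $v,w$ with $vp=p$, $vq=q$, $pw=p$, $qw=q$ (same start and same end vertex). Let $\pi\colon KQ\to\Lambda=KQ/I$ be the canonical surjection. The quasi-commuting ideal $C^f$ of $\Lambda$ and $f$ is the two-sided ideal of $\Lambda$ generated by all elements $f(p)\pi(p)-f(q)\pi(q)$ with $p,q\in\mathcal{B}$, $p\|q$; the algebra $\Lambda/C^f$ is the quasi-commuting algebra of $\Lambda$ and $f$. No assumption is made that $I$ is finitely generated or that $\Lambda$ is finite dimensional. The notation $v_i(\Lambda/C^f)v_j$ uses the images of the vertices in $\Lambda/C^f$. *)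

theory Defs
  imports "HOL-Algebra.QuotRing" "Graph_Theory.Arc_Walk" "Jordan_Normal_Form.Missing_VectorSpace"
begin

text \<open>
  Quivers are multidigraphs (\<^typ>\<open>('v, 'e) pre_digraph\<close>, with loops and parallel arcs allowed).
  A path is recorded as (start vertex, list of arrows, end vertex), so that each vertex \<open>v\<close> has
  its own path of length zero \<open>(v, [], v)\<close>. Paths are composed from left to right.
\<close>

type_synonym ('v, 'e) qpath = "'v \<times> 'e list \<times> 'v"

definition qpaths :: "('v, 'e) pre_digraph \<Rightarrow> ('v, 'e) qpath set" where
  "qpaths Q = {(u, p, w). pre_digraph.awalk Q u p w}"

definition qlength :: "('v, 'e) qpath \<Rightarrow> nat" where
  "qlength p = length (fst (snd p))"

definition qparallel :: "('v, 'e) qpath \<Rightarrow> ('v, 'e) qpath \<Rightarrow> bool" where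
  "qparallel p q \<longleftrightarrow> fst p = fst q \<and> snd (snd p) = snd (snd q)"

text \<open>All ways of writing a path as a composition of two paths; this is a finite set.\<close>

definition qfactorizations ::
  "('v, 'e) pre_digraph \<Rightarrow> ('v, 'e) qpath \<Rightarrow> (('v, 'e) qpath \<times> ('v, 'e) qpath) set" where
  "qfactorizations Q s =
     {(q, r). q \<in> qpaths Q \<and> r \<in> qpaths Q \<and>
        (\<exists>u p v p' w. q = (u, p, v) \<and> r = (v, p', w) \<and> s = (u, p @ p', w))}"

text \<open>
  Elements of the path algebra are finitely supported coefficient functions on the set of paths,
  extended by zero to the whole type. In the product, the coefficient of \<open>s\<close> collects the terms
  \<open>x q \<otimes> y r\<close> over all pairs with \<open>s = q r\<close>; non-composable pairs contribute nothing.
\<close>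

definition path_algebra ::
  "('k, 'm) ring_scheme \<Rightarrow> ('v, 'e) pre_digraph \<Rightarrow> ('k, ('v, 'e) qpath \<Rightarrow> 'k) module" where
  "path_algebra K Q =
    \<lparr>carrier = {x. (\<forall>p. x p \<in> carrier K) \<and> (\<forall>p. p \<notin> qpaths Q \<longrightarrow> x p = \<zero>\<^bsub>K\<^esub>)
                  \<and> finite {p. x p \<noteq> \<zero>\<^bsub>K\<^esub>}},
     mult = (\<lambda>x y s. \<Oplus>\<^bsub>K\<^esub>qr\<in>qfactorizations Q s. x (fst qr) \<otimes>\<^bsub>K\<^esub> y (snd qr)),
     one = (\<lambda>s. if \<exists>v\<in>verts Q. s = (v, [], v) then \<one>\<^bsub>K\<^esub> else \<zero>\<^bsub>K\<^esub>),
     zero = (\<lambda>s. \<zero>\<^bsub>K\<^esub>),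
     add = (\<lambda>x y s. x s \<oplus>\<^bsub>K\<^esub> y s),
     smult = (\<lambda>c x s. c \<otimes>\<^bsub>K\<^esub> x s)\<rparr>"

text \<open>The path \<open>p\<close> as an element of the path algebra.\<close>

definition path_elem :: "('k, 'm) ring_scheme \<Rightarrow> ('v, 'e) qpath \<Rightarrow> ('v, 'e) qpath \<Rightarrow> 'k" where
  "path_elem K p = (\<lambda>s. if s = p then \<one>\<^bsub>K\<^esub> else \<zero>\<^bsub>K\<^esub>)"

abbreviation vertex_elem :: "('k, 'm) ring_scheme \<Rightarrow> 'v \<Rightarrow> ('v, 'e) qpath \<Rightarrow> 'k" where
  "vertex_elem K v \<equiv> path_elem K (v, [], v)"

text \<open>
  The quotient of an algebra by a two-sided ideal: the ring \<^term>\<open>A Quot I\<close> with the induced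
  scalar multiplication \<open>c (I + x) = I + c x\<close>. The canonical surjection is \<open>x \<mapsto> I +>\<^bsub>A\<^esub> x\<close>.
\<close>

definition factor_algebra ::
  "('k, 'a, 'm) module_scheme \<Rightarrow> 'a set \<Rightarrow> ('k, 'a set) module" where
  "factor_algebra A I =
     ring.extend (A Quot I) (module.fields (\<lambda>c X. \<Union>x\<in>X. I +>\<^bsub>A\<^esub> (c \<odot>\<^bsub>A\<^esub> x)))"

definition quasi_commuting_ideal ::
  "('k, 'm) ring_scheme \<Rightarrow> ('v, 'e) pre_digraph \<Rightarrow> (('v, 'e) qpath \<Rightarrow> 'k) set
    \<Rightarrow> (('v, 'e) qpath \<Rightarrow> 'k) \<Rightarrow> (('v, 'e) qpath \<Rightarrow> 'k) set set" where
  "quasi_commuting_ideal K Q I f =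
    (let KQ = path_algebra K Q;
         L = factor_algebra KQ I;
         \<pi> = (\<lambda>x. I +>\<^bsub>KQ\<^esub> x)
     in Idl\<^bsub>L\<^esub> {(f p \<odot>\<^bsub>L\<^esub> \<pi> (path_elem K p)) \<ominus>\<^bsub>L\<^esub> (f q \<odot>\<^bsub>L\<^esub> \<pi> (path_elem K q)) | p q.
               p \<in> qpaths Q \<and> q \<in> qpaths Q \<and> qparallel p q})"

definition quasi_commuting_algebra ::
  "('k, 'm) ring_scheme \<Rightarrow> ('v, 'e) pre_digraph \<Rightarrow> (('v, 'e) qpath \<Rightarrow> 'k) set
    \<Rightarrow> (('v, 'e) qpath \<Rightarrow> 'k) \<Rightarrow> ('k, (('v, 'e) qpath \<Rightarrow> 'k) set set) module" where
  "quasi_commuting_algebra K Q I f =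
     factor_algebra (factor_algebra (path_algebra K Q) I) (quasi_commuting_ideal K Q I f)"

text \<open>The image of a vertex of \<open>Q\<close> in the quasi-commuting algebra.\<close>

definition vertex_image ::
  "('k, 'm) ring_scheme \<Rightarrow> ('v, 'e) pre_digraph \<Rightarrow> (('v, 'e) qpath \<Rightarrow> 'k) set
    \<Rightarrow> (('v, 'e) qpath \<Rightarrow> 'k) \<Rightarrow> 'v \<Rightarrow> (('v, 'e) qpath \<Rightarrow> 'k) set set" where
  "vertex_image K Q I f v =
     quasi_commuting_ideal K Q I f +>\<^bsub>factor_algebra (path_algebra K Q) I\<^esub>
       (I +>\<^bsub>path_algebra K Q\<^esub> vertex_elem K v)"

text \<open>The subspace \<open>a A b\<close> of an algebra \<open>A\<close>.\<close>

definition corner ::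
  "('k, 'a, 'm) module_scheme \<Rightarrow> 'a \<Rightarrow> 'a \<Rightarrow> ('k, 'a, 'm) module_scheme" where
  "corner A a b = A\<lparr>carrier := {a \<otimes>\<^bsub>A\<^esub> x \<otimes>\<^bsub>A\<^esub> b | x. x \<in> carrier A}\<rparr>"

text \<open>
  \<open>dim V \<le> m\<close> has to include finite dimensionality: \<^const>\<open>vectorspace.dim\<close> is a least cardinality
  of a finite generating set, hence unspecified if there is none.
\<close>

definition fin_dim_le ::
  "('k, 'm) ring_scheme \<Rightarrow> ('k, 'a, 'n) module_scheme \<Rightarrow> nat \<Rightarrow> bool" where
  "fin_dim_le K V m \<longleftrightarrow>
     vectorspace K V \<and> vectorspace.fin_dim K V \<and> vectorspace.dim K V \<le> m"

end

theory Submission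
  imports Defs
begin

text \<open>
  Write \<open>B\<close> for the quasi-commuting algebra and \<open>h\<close> for the composite of the two canonical
  surjections from the path algebra to \<open>B\<close>. If \<open>p\<close> and \<open>q\<close> are parallel paths, then
  \<open>f p \<cdot> h p = f q \<cdot> h q\<close> by the choice of the generators of the ideal, and since
  \<open>f p\<close> is a unit of the field, \<open>h p\<close> is a scalar multiple of \<open>h q\<close>. So for all
  vertices \<open>u\<close> and \<open>w\<close> the images of the paths from \<open>u\<close> to \<open>w\<close> lie on one line,
  spanned by the image of any single such path.

  The paths span the path algebra, hence their images span \<open>B\<close>. Multiplying by the vertices
  \<open>u\<close> on the left and \<open>w\<close> on the right fixes the paths from \<open>u\<close> to \<open>w\<close> and kills
  all others, so the corner of \<open>B\<close> at \<open>u\<close> and \<open>w\<close> is contained in that line: this is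
  the first claim (\<open>corner_fin_dim_le\<close>). One spanning vector for each of the \<open>n\<^sup>2\<close> pairs
  of vertices gives a spanning set of \<open>B\<close>: this is the second claim
  (\<open>quotient_fin_dim_le\<close>).

  Both claims hold for every surjective algebra homomorphism out of the path algebra that makes
  parallel paths proportional in this way; the locale \<open>quasi_commuting_hom\<close> isolates this
  situation, so that the iterated cosets of \<open>B\<close> are dealt with only once, in
  \<open>quasi_commuting_algebra_hom\<close>.
\<close>

section \<open>Associative algebras and their factor algebras\<close>

text \<open>
  Unital algebras over a commutative ring whose multiplication may fail to commute, as it does for
  paths. The locale \<^locale>\<open>algebra\<close> covers commutative algebras only.
\<close>

locale assoc_algebra = module R A + ring A for R and A (structure) +
  assumes smult_mult_left: "\<lbrakk>c \<in> carrier R; x \<in> carrier A; y \<in> carrier A\<rbrakk> \<Longrightarrow>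
      (c \<odot> x) \<otimes> y = c \<odot> (x \<otimes> y)"
    and smult_mult_right: "\<lbrakk>c \<in> carrier R; x \<in> carrier A; y \<in> carrier A\<rbrakk> \<Longrightarrow>
      x \<otimes> (c \<odot> y) = c \<odot> (x \<otimes> y)"

locale algebra_hom = A: assoc_algebra R A + B: assoc_algebra R B + ring_hom_ring A B h
  for R and A (structure) and B (structure) and h +
  assumes hom_smult: "\<lbrakk>c \<in> carrier R; x \<in> carrier A\<rbrakk> \<Longrightarrow> h (c \<odot>\<^bsub>A\<^esub> x) = c \<odot>\<^bsub>B\<^esub> h x"

text \<open>
  The ring axioms concern only the ring operations, so a quotient ring remains a ring when a scalar
  multiplication is attached to it.
\<close>

lemma ring_extend:
  fixes S :: "'a ring"
  assumes "ring S"
  shows "ring (ring.extend S m)"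
proof -
  interpret ring S by fact
  have inv: "\<exists>y\<in>carrier S. y \<oplus>\<^bsub>S\<^esub> x = \<zero>\<^bsub>S\<^esub>" if "x \<in> carrier S" for x
    using that l_neg by blast
  show ?thesis
    by (intro ringI abelian_groupI Group.monoidI)
      (auto simp: ring.defs monoid.defs partial_object.defs inv a_assoc m_assoc l_distr r_distr intro: a_comm)
qed

lemma factor_algebra_simps [simp]:
  "carrier (factor_algebra A I) = a_rcosets\<^bsub>A\<^esub> I"
  "mult (factor_algebra A I) = rcoset_mult A I"
  "one (factor_algebra A I) = I +>\<^bsub>A\<^esub> \<one>\<^bsub>A\<^esub>"
  "zero (factor_algebra A I) = I"
  "add (factor_algebra A I) = set_add A"
  by (simp_all add: factor_algebra_def FactRing_def ring.defs module.defs)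

context assoc_algebra
begin

text \<open>
  An ideal is by definition closed under multiplication by elements of the ring only. The unit
  turns scalars into such elements, \<open>c x = (c 1) x\<close>, so ideals are also subspaces.
\<close>

lemma ideal_smult_closed:
  assumes "ideal I A" "c \<in> carrier R" "x \<in> I"
  shows "c \<odot> x \<in> I"
proof -
  interpret I: ideal I A by fact
  have "c \<odot> x = (c \<odot> \<one>) \<otimes> x"
    using assms I.Icarr by (simp add: smult_mult_left)
  then show ?thesis
    using assms I.I_l_closed by simp
qed

text \<open>
  The scalar multiple of a coset is defined as a union over all representatives. Each of them
  contributes the same coset because the ideal is a subspace.
\<close>

lemma factor_algebra_smult:
  assumes "ideal I A" "c \<in> carrier R" "x \<in> carrier A"
  shows "c \<odot>\<^bsub>factor_algebra A I\<^esub> (I +> x) = I +> (c \<odot> x)"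
proof -
  interpret I: ideal I A by fact
  have "I +> (c \<odot> y) = I +> (c \<odot> x)" if y: "y \<in> I +> x" for y
  proof -
    obtain i where i: "i \<in> I" "y = i \<oplus> x"
      using y unfolding a_r_coset_def' by blast
    then have "c \<odot> y = c \<odot> i \<oplus> c \<odot> x"
      using assms I.Icarr smult_r_distr by simp
    moreover have "c \<odot> i \<in> I"
      using ideal_smult_closed assms i by blast
    ultimately have "c \<odot> y \<in> I +> (c \<odot> x)"
      unfolding a_r_coset_def' by blast
    then show ?thesis
      using a_repr_independence[OF _ smult_closed[OF assms(2,3)] I.a_subgroup] by simp
  qed
  then have "(\<Union>y\<in>I +> x. I +> (c \<odot> y)) = (\<Union>y\<in>I +> x. I +> (c \<odot> x))"
    by (rule SUP_cong[OF refl])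
  also have "\<dots> = I +> (c \<odot> x)"
    using I.a_rcos_self[OF assms(3)] by blast
  finally show ?thesis
    by (simp add: factor_algebra_def ring.defs module.defs)
qed

lemma factor_algebra_is_assoc_algebra:
  assumes "ideal I A"
  shows "assoc_algebra R (factor_algebra A I)"
proof -
  interpret I: ideal I A by fact
  let ?L = "factor_algebra A I"
  have r: "ring ?L"
    unfolding factor_algebra_def using I.quotient_is_ring by (rule ring_extend)
  interpret L: ring ?L by (rule r)
  have carr: "carrier ?L = (+>) I ` carrier A"
    by (auto simp: A_RCOSETS_def')
  have add: "(I +> x) \<oplus>\<^bsub>?L\<^esub> (I +> y) = I +> (x \<oplus> y)" if "x \<in> carrier A" "y \<in> carrier A" for x y
    using that I.a_rcos_sum by simp
  have mult: "(I +> x) \<otimes>\<^bsub>?L\<^esub> (I +> y) = I +> (x \<otimes> y)" if "x \<in> carrier A" "y \<in> carrier A" for x y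
    using that I.rcoset_mult_add by simp
  note [simp] = carr add mult factor_algebra_smult[OF assms]
  note [simp del] = factor_algebra_simps
  have "module R ?L"
    by (rule moduleI) (auto simp: smult_l_distr smult_r_distr smult_assoc1
        intro: R.is_cring L.is_abelian_group)
  then show ?thesis
    by (intro assoc_algebra.intro assoc_algebra_axioms.intro r)
      (auto simp: smult_mult_left smult_mult_right)
qed

lemma coset_algebra_hom:
  assumes "ideal I A"
  shows "algebra_hom R A (factor_algebra A I) ((+>) I)"
proof -
  interpret I: ideal I A by fact
  interpret L: assoc_algebra R "factor_algebra A I"
    using assms by (rule factor_algebra_is_assoc_algebra)
  have "(+>) I \<in> ring_hom A (factor_algebra A I)"
    by (auto intro!: ring_hom_memI simp: a_rcosetsI[OF I.a_subset] I.rcoset_mult_add I.a_rcos_sum)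
  then have "ring_hom_ring A (factor_algebra A I) ((+>) I)"
    by (intro ring_hom_ringI2 ring_axioms L.ring_axioms)
  then show ?thesis
    by (intro algebra_hom.intro algebra_hom_axioms.intro assoc_algebra_axioms
       L.assoc_algebra_axioms factor_algebra_smult[OF assms, symmetric])
qed

lemma corner_is_module:
  assumes "a \<in> carrier A" "b \<in> carrier A"
  shows "module R (corner A a b)"
proof -
  let ?W = "{a \<otimes> x \<otimes> b | x. x \<in> carrier A}"
  have "Module.submodule ?W R A"
  proof (rule submoduleI)
    show "\<zero> \<in> ?W"
      using assms by (auto intro!: exI[of _ \<zero>])
  next
    fix w assume "w \<in> ?W"
    then obtain x where "x \<in> carrier A" "w = a \<otimes> x \<otimes> b" by blast
    then show "\<ominus> w \<in> ?W"
      using assms by (auto intro!: exI[of _ "\<ominus> x"] simp: l_minus r_minus)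
  next
    fix w z assume "w \<in> ?W" "z \<in> ?W"
    then obtain x y where "x \<in> carrier A" "w = a \<otimes> x \<otimes> b" "y \<in> carrier A" "z = a \<otimes> y \<otimes> b"
      by blast
    then show "w \<oplus> z \<in> ?W"
      using assms by (auto intro!: exI[of _ "x \<oplus> y"] simp: l_distr r_distr)
  next
    fix c w assume "c \<in> carrier R" "w \<in> ?W"
    then obtain x where "x \<in> carrier A" "w = a \<otimes> x \<otimes> b" "c \<in> carrier R" by blast
    then show "c \<odot> w \<in> ?W"
      using assms by (auto intro!: exI[of _ "c \<odot> x"] simp: smult_mult_left smult_mult_right)
  qed (use assms in auto)
  then show ?thesis
    unfolding corner_def
    by (rule submodule.submodule_is_module) (rule module_axioms)
qed

end

lemma algebra_hom_comp:
  assumes "algebra_hom R A B g" "algebra_hom R B C h"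
  shows "algebra_hom R A C (\<lambda>x. h (g x))"
proof -
  interpret g: algebra_hom R A B g by fact
  interpret h: algebra_hom R B C h by fact
  have "(\<lambda>x. h (g x)) \<in> ring_hom A C"
    by (auto intro!: ring_hom_memI)
  then show ?thesis
    by (intro algebra_hom.intro algebra_hom_axioms.intro ring_hom_ringI2
        g.A.assoc_algebra_axioms h.B.assoc_algebra_axioms g.A.ring_axioms h.B.ring_axioms)
      (auto simp: g.hom_smult h.hom_smult)
qed

section \<open>Upper bounds for dimensions\<close>

text \<open>
  The dimension is the least size of a finite generating set, so one such set is enough both for
  finite dimensionality and for the bound.
\<close>

lemma fin_dim_leI_span:
  assumes "vectorspace K V" "finite S" "S \<subseteq> carrier V" "carrier V \<subseteq> module.span K V S"
    and "card S \<le> m"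
  shows "fin_dim_le K V m"
proof -
  interpret vectorspace K V by fact
  have "gen_set S"
    using assms span_is_subset2 by blast
  then show ?thesis
    unfolding fin_dim_le_def fin_dim_def using assms gen_ge_dim[of S] by fastforce
qed

lemma fin_dim_leI_line:
  assumes "vectorspace K V" "r \<in> carrier V"
    and line: "\<And>x. x \<in> carrier V \<Longrightarrow> \<exists>c\<in>carrier K. x = c \<odot>\<^bsub>V\<^esub> r"
  shows "fin_dim_le K V 1"
proof (rule fin_dim_leI_span[of _ _ "{r}"])
  interpret vectorspace K V by fact
  interpret S: LinearCombinations.submodule K "span {r}" V
    using assms span_is_submodule by blast
  have "r \<in> span {r}"
    using in_own_span[of "{r}"] assms by blast
  then show "carrier V \<subseteq> span {r}"
    using line S.smult_closed by blast
qed (use assms in auto)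


section \<open>The path algebra\<close>

lemma path_algebra_simps [simp]:
  "x \<in> carrier (path_algebra K Q) \<longleftrightarrow> (\<forall>p. x p \<in> carrier K) \<and> (\<forall>p. p \<notin> qpaths Q \<longrightarrow> x p = \<zero>\<^bsub>K\<^esub>)
     \<and> finite {p. x p \<noteq> \<zero>\<^bsub>K\<^esub>}"
  "mult (path_algebra K Q) = (\<lambda>x y s. \<Oplus>\<^bsub>K\<^esub>qr\<in>qfactorizations Q s. x (fst qr) \<otimes>\<^bsub>K\<^esub> y (snd qr))"
  "zero (path_algebra K Q) = (\<lambda>s. \<zero>\<^bsub>K\<^esub>)"
  "add (path_algebra K Q) = (\<lambda>x y s. x s \<oplus>\<^bsub>K\<^esub> y s)"
  "smult (path_algebra K Q) = (\<lambda>c x s. c \<otimes>\<^bsub>K\<^esub> x s)"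
  by (simp_all add: path_algebra_def)

lemma coeff_closed: "x \<in> carrier (path_algebra K Q) \<Longrightarrow> x p \<in> carrier K"
  by (simp del: split_paired_All)

lemma coeff_outside_qpaths:
  "\<lbrakk>x \<in> carrier (path_algebra K Q); p \<notin> qpaths Q\<rbrakk> \<Longrightarrow> x p = \<zero>\<^bsub>K\<^esub>"
  by (simp del: split_paired_All)

lemma (in pre_digraph) cas_end_unique: "cas u p v \<Longrightarrow> cas u p v' \<Longrightarrow> v = v'"
  by (induction p arbitrary: u) auto

text \<open>
  A factorization of a path is determined by the length of its first factor: the arrows of the first
  factor fix the vertex at which the path is cut.
\<close>

lemma finite_qfactorizations: "finite (qfactorizations Q s)"
proof (rule inj_on_finite)
  show "inj_on (\<lambda>qr. qlength (fst qr)) (qfactorizations Q s)"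
  proof (rule inj_onI)
    fix x y
    assume x: "x \<in> qfactorizations Q s" and y: "y \<in> qfactorizations Q s"
      and len: "qlength (fst x) = qlength (fst y)"
    obtain u p v p' w where 1: "x = ((u, p, v), (v, p', w))" "s = (u, p @ p', w)"
        "pre_digraph.awalk Q u p v"
      using x unfolding qfactorizations_def qpaths_def by blast
    obtain u2 q v2 q' w2 where 2: "y = ((u2, q, v2), (v2, q', w2))" "s = (u2, q @ q', w2)"
        "pre_digraph.awalk Q u2 q v2"
      using y unfolding qfactorizations_def qpaths_def by blast
    have "u = u2" "w = w2" "p = q" "p' = q'"
      using 1 2 len by (auto simp: qlength_def)
    moreover have "pre_digraph.cas Q u p v" "pre_digraph.cas Q u2 q v2"
      using 1(3) 2(3) by (simp_all add: pre_digraph.awalk_def)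
    then have "v = v2"
      using calculation pre_digraph.cas_end_unique[of Q u p v v2] by simp
    ultimately show "x = y"
      using 1(1) 2(1) by simp
  qed
  show "(\<lambda>qr. qlength (fst qr)) ` qfactorizations Q s \<subseteq> {..qlength s}"
    by (auto simp: qfactorizations_def qlength_def)
qed simp

text \<open>
  That the path algebra is a ring is taken as a hypothesis, as it is part of what it means to speak
  of an ideal of it. What is added here is the compatibility with scalars; the finiteness of the
  set of factorizations lets scalars move through the sums defining products.
\<close>

lemma path_algebra_is_assoc_algebra:
  fixes K :: "('k, 'm) ring_scheme" and Q :: "('v, 'e) pre_digraph"
  assumes "cring K" "ring (path_algebra K Q)"
  shows "assoc_algebra K (path_algebra K Q)"
proof -
  interpret K: cring K by fact
  interpret A: ring "path_algebra K Q" by fact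
  have fin: "finite {p. c \<otimes>\<^bsub>K\<^esub> x p \<noteq> \<zero>\<^bsub>K\<^esub>}"
    if "finite {p. x p \<noteq> \<zero>\<^bsub>K\<^esub>}" "c \<in> carrier K" for c and x :: "('v, 'e) qpath \<Rightarrow> 'k"
    using that(1) by (rule rev_finite_subset) (use that(2) in auto)
  have "module K (path_algebra K Q)"
  proof (rule moduleI)
    show "abelian_group (path_algebra K Q)"
      by (rule A.is_abelian_group)
  qed (auto simp: fin fun_eq_iff K.is_cring K.l_distr K.r_distr K.m_assoc)
  then show ?thesis
  proof (intro assoc_algebra.intro assoc_algebra_axioms.intro A.ring_axioms)
    fix c x y
    assume c: "c \<in> carrier K"
      and "x \<in> carrier (path_algebra K Q)" "y \<in> carrier (path_algebra K Q)"
    then have [simp]: "x p \<in> carrier K" "y p \<in> carrier K" for p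
      by (simp_all add: coeff_closed del: path_algebra_simps)
    have *: "c \<otimes>\<^bsub>K\<^esub> (\<Oplus>\<^bsub>K\<^esub>qr\<in>qfactorizations Q s. x (fst qr) \<otimes>\<^bsub>K\<^esub> y (snd qr)) =
        (\<Oplus>\<^bsub>K\<^esub>qr\<in>qfactorizations Q s. c \<otimes>\<^bsub>K\<^esub> (x (fst qr) \<otimes>\<^bsub>K\<^esub> y (snd qr)))" for s
      using c by (intro K.finsum_rdistr finite_qfactorizations) auto
    show "(c \<odot>\<^bsub>path_algebra K Q\<^esub> x) \<otimes>\<^bsub>path_algebra K Q\<^esub> y =
        c \<odot>\<^bsub>path_algebra K Q\<^esub> (x \<otimes>\<^bsub>path_algebra K Q\<^esub> y)"
      using c by (simp add: * K.m_assoc)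
    show "x \<otimes>\<^bsub>path_algebra K Q\<^esub> (c \<odot>\<^bsub>path_algebra K Q\<^esub> y) =
        c \<odot>\<^bsub>path_algebra K Q\<^esub> (x \<otimes>\<^bsub>path_algebra K Q\<^esub> y)"
      using c by (simp add: * K.m_lcomm)
  qed
qed

lemma path_elem_closed:
  assumes "ring K" "p \<in> qpaths Q"
  shows "path_elem K p \<in> carrier (path_algebra K Q)"
proof -
  interpret K: ring K by fact
  have "finite {q. path_elem K p q \<noteq> \<zero>\<^bsub>K\<^esub>}"
    by (rule finite_subset[of _ "{p}"]) (auto simp: path_elem_def)
  then show ?thesis
    using assms by (auto simp: path_elem_def)
qed

text \<open>
  The product of two paths is their concatenation if they are composable, and zero otherwise. The
  formulation by \<^const>\<open>qfactorizations\<close> covers both cases at once.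
\<close>

lemma path_elem_mult:
  assumes "ring K"
  shows "path_elem K q \<otimes>\<^bsub>path_algebra K Q\<^esub> path_elem K r =
    (\<lambda>s. if (q, r) \<in> qfactorizations Q s then \<one>\<^bsub>K\<^esub> else \<zero>\<^bsub>K\<^esub>)"
proof
  interpret K: ring K by fact
  fix s
  let ?F = "qfactorizations Q s"
  have "(\<Oplus>\<^bsub>K\<^esub>x\<in>?F. path_elem K q (fst x) \<otimes>\<^bsub>K\<^esub> path_elem K r (snd x)) =
      (\<Oplus>\<^bsub>K\<^esub>x\<in>?F. if x = (q, r) then \<one>\<^bsub>K\<^esub> else \<zero>\<^bsub>K\<^esub>)"
    by (rule K.finsum_cong') (auto simp: path_elem_def)
  also have "\<dots> = (if (q, r) \<in> ?F then \<one>\<^bsub>K\<^esub> else \<zero>\<^bsub>K\<^esub>)"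
  proof (cases "(q, r) \<in> ?F")
    case True
    then show ?thesis
      using K.add.finprod_singleton_swap[OF True finite_qfactorizations, of "\<lambda>_. \<one>\<^bsub>K\<^esub>"] by simp
  next
    case False
    then have "(\<Oplus>\<^bsub>K\<^esub>x\<in>?F. if x = (q, r) then \<one>\<^bsub>K\<^esub> else \<zero>\<^bsub>K\<^esub>) = \<zero>\<^bsub>K\<^esub>"
      by (intro K.add.finprod_one_eqI) auto
    with False show ?thesis by simp
  qed
  finally show "(path_elem K q \<otimes>\<^bsub>path_algebra K Q\<^esub> path_elem K r) s =
      (if (q, r) \<in> ?F then \<one>\<^bsub>K\<^esub> else \<zero>\<^bsub>K\<^esub>)"
    by simp
qed

lemma trivial_path_in_qpaths: "u \<in> verts Q \<Longrightarrow> (u, [], u) \<in> qpaths Q"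
  by (simp add: qpaths_def pre_digraph.awalk_def pre_digraph.cas.simps)

lemma vertex_elem_mult:
  assumes "ring K" "p \<in> qpaths Q" "u \<in> verts Q"
  shows "vertex_elem K u \<otimes>\<^bsub>path_algebra K Q\<^esub> path_elem K p =
    (if fst p = u then path_elem K p else \<zero>\<^bsub>path_algebra K Q\<^esub>)"
proof -
  have "((u, [], u), p) \<in> qfactorizations Q s \<longleftrightarrow> s = p \<and> fst p = u" for s
    using assms(2) trivial_path_in_qpaths[OF assms(3)]
    by (cases p) (auto simp: qfactorizations_def)
  then show ?thesis
    unfolding path_elem_mult[OF assms(1)] by (auto simp: path_elem_def)
qed

lemma mult_vertex_elem:
  assumes "ring K" "p \<in> qpaths Q" "w \<in> verts Q"
  shows "path_elem K p \<otimes>\<^bsub>path_algebra K Q\<^esub> vertex_elem K w =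
    (if snd (snd p) = w then path_elem K p else \<zero>\<^bsub>path_algebra K Q\<^esub>)"
proof -
  have "(p, (w, [], w)) \<in> qfactorizations Q s \<longleftrightarrow> s = p \<and> snd (snd p) = w" for s
    using assms(2) trivial_path_in_qpaths[OF assms(3)]
    by (cases p) (auto simp: qfactorizations_def)
  then show ?thesis
    unfolding path_elem_mult[OF assms(1)] by (auto simp: path_elem_def)
qed

text \<open>
  The paths span the path algebra, in the form of an induction principle: a property that holds for
  paths and is preserved by linear combinations holds everywhere. The proof splits off one path of
  the finite support at a time.
\<close>

lemma path_algebra_induct [consumes 2, case_names zero path add smult]:
  assumes "ring K" and "x \<in> carrier (path_algebra K Q)"
    and zero: "P \<zero>\<^bsub>path_algebra K Q\<^esub>"
    and path: "\<And>p. p \<in> qpaths Q \<Longrightarrow> P (path_elem K p)"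
    and add: "\<And>x y. \<lbrakk>x \<in> carrier (path_algebra K Q); y \<in> carrier (path_algebra K Q); P x; P y\<rbrakk>
                \<Longrightarrow> P (x \<oplus>\<^bsub>path_algebra K Q\<^esub> y)"
    and smult: "\<And>c x. \<lbrakk>c \<in> carrier K; x \<in> carrier (path_algebra K Q); P x\<rbrakk>
                \<Longrightarrow> P (c \<odot>\<^bsub>path_algebra K Q\<^esub> x)"
  shows "P x"
proof -
  interpret K: ring K by fact
  have "P x" if "finite S" "x \<in> carrier (path_algebra K Q)" "{p. x p \<noteq> \<zero>\<^bsub>K\<^esub>} \<subseteq> S" for S x
    using that
  proof (induction S arbitrary: x)
    case empty
    then have "x = \<zero>\<^bsub>path_algebra K Q\<^esub>"
      by auto
    then show ?case
      using zero by simp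
  next
    case (insert p S)
    show ?case
    proof (cases "p \<in> qpaths Q")
      case False
      then have "x p = \<zero>\<^bsub>K\<^esub>"
        using insert.prems(1) by (intro coeff_outside_qpaths)
      then have "{q. x q \<noteq> \<zero>\<^bsub>K\<^esub>} \<subseteq> S"
        using insert.prems(2) by blast
      then show ?thesis
        using insert.IH insert.prems(1) by blast
    next
      case True
      let ?y = "x(p := \<zero>\<^bsub>K\<^esub>)" and ?z = "x p \<odot>\<^bsub>path_algebra K Q\<^esub> path_elem K p"
      have "finite {q. ?y q \<noteq> \<zero>\<^bsub>K\<^esub>}"
        by (rule finite_subset[of _ S]) (use insert in auto)
      then have y: "?y \<in> carrier (path_algebra K Q)"
        using insert.prems by auto
      have xp: "x p \<in> carrier K"
        using insert.prems(1) by (rule coeff_closed)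
      have z: "?z \<in> carrier (path_algebra K Q)"
        using True xp by (auto simp: path_elem_def intro!: finite_subset[of _ "{p}"])
      have "P ?y"
      proof (rule insert.IH[OF y])
        show "{q. ?y q \<noteq> \<zero>\<^bsub>K\<^esub>} \<subseteq> S"
          using insert.prems(2) by auto
      qed
      moreover have "P ?z"
        using True xp by (intro smult path path_elem_closed K.ring_axioms)
      moreover have "x = ?z \<oplus>\<^bsub>path_algebra K Q\<^esub> ?y"
        using xp coeff_closed[OF insert.prems(1)]
        by (auto simp: path_elem_def fun_eq_iff simp del: split_paired_All)
      ultimately show ?thesis
        using add[OF z y] by simp
    qed
  qed
  then show ?thesis
    using assms(2) by auto
qed

text \<open>
  From here on the path algebra is used through its algebra structure only; its elements are no
  longer to be unfolded into coefficient functions.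
\<close>

declare path_algebra_simps [simp del]

section \<open>Quotients in which parallel paths are proportional\<close>

locale quasi_commuting_hom =
  K: field K + fin_digraph Q + algebra_hom K "path_algebra K Q" B h
  for K (structure) and Q :: "('v, 'e) pre_digraph" and B (structure) and h +
  fixes f
  assumes surj: "h ` carrier (path_algebra K Q) = carrier B"
    and f_nonzero: "p \<in> qpaths Q \<Longrightarrow> f p \<in> carrier K - {\<zero>\<^bsub>K\<^esub>}"
    and quasi_commute: "\<lbrakk>p \<in> qpaths Q; q \<in> qpaths Q; qparallel p q\<rbrakk> \<Longrightarrow>
        f p \<odot>\<^bsub>B\<^esub> h (path_elem K p) = f q \<odot>\<^bsub>B\<^esub> h (path_elem K q)"
begin

lemma path_closed: "p \<in> qpaths Q \<Longrightarrow> path_elem K p \<in> carrier (path_algebra K Q)"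
  using K.ring_axioms by (rule path_elem_closed)

lemma vertex_closed: "u \<in> verts Q \<Longrightarrow> h (vertex_elem K u) \<in> carrier B"
  by (intro hom_closed path_closed trivial_path_in_qpaths)

text \<open>
  Vertices act on paths as projections onto the paths with the prescribed ends.
\<close>

lemma corner_path:
  assumes "u \<in> verts Q" "w \<in> verts Q" "p \<in> qpaths Q"
  shows "h (vertex_elem K u) \<otimes>\<^bsub>B\<^esub> h (path_elem K p) \<otimes>\<^bsub>B\<^esub> h (vertex_elem K w) =
     (if fst p = u \<and> snd (snd p) = w then h (path_elem K p) else \<zero>\<^bsub>B\<^esub>)"
proof -
  have [simp]: "path_elem K p \<in> carrier (path_algebra K Q)"
    "vertex_elem K u \<in> carrier (path_algebra K Q)" "vertex_elem K w \<in> carrier (path_algebra K Q)"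
    using assms by (simp_all add: path_closed trivial_path_in_qpaths)
  have product: "vertex_elem K u \<otimes>\<^bsub>path_algebra K Q\<^esub> path_elem K p \<otimes>\<^bsub>path_algebra K Q\<^esub> vertex_elem K w =
     (if fst p = u \<and> snd (snd p) = w then path_elem K p else \<zero>\<^bsub>path_algebra K Q\<^esub>)"
    using assms K.ring_axioms by (simp add: vertex_elem_mult mult_vertex_elem)
  have "h (vertex_elem K u) \<otimes>\<^bsub>B\<^esub> h (path_elem K p) \<otimes>\<^bsub>B\<^esub> h (vertex_elem K w) =
     h (vertex_elem K u \<otimes>\<^bsub>path_algebra K Q\<^esub> path_elem K p \<otimes>\<^bsub>path_algebra K Q\<^esub> vertex_elem K w)"
    by simp
  also have "\<dots> = h (if fst p = u \<and> snd (snd p) = w then path_elem K p else \<zero>\<^bsub>path_algebra K Q\<^esub>)"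
    unfolding product ..
  finally show ?thesis
    by simp
qed

text \<open>
  The only place where the values of \<open>f\<close> have to be invertible.
\<close>

lemma parallel_paths_proportional:
  assumes "p \<in> qpaths Q" "q \<in> qpaths Q" "qparallel p q"
  shows "\<exists>c\<in>carrier K. h (path_elem K p) = c \<odot>\<^bsub>B\<^esub> h (path_elem K q)"
proof
  have [simp]: "h (path_elem K p) \<in> carrier B" "h (path_elem K q) \<in> carrier B"
    using assms by (simp_all add: path_closed)
  have [simp]: "f p \<in> carrier K" "f q \<in> carrier K" "inv f p \<in> carrier K" "inv f p \<otimes> f p = \<one>"
    using assms f_nonzero K.field_Units by auto
  show "inv f p \<otimes> f q \<in> carrier K"
    by simp
  have "h (path_elem K p) = (inv f p \<otimes> f p) \<odot>\<^bsub>B\<^esub> h (path_elem K p)"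
    by simp
  also have "\<dots> = inv f p \<odot>\<^bsub>B\<^esub> (f p \<odot>\<^bsub>B\<^esub> h (path_elem K p))"
    by (rule B.smult_assoc1) simp_all
  also have "\<dots> = inv f p \<odot>\<^bsub>B\<^esub> (f q \<odot>\<^bsub>B\<^esub> h (path_elem K q))"
    using assms quasi_commute by simp
  also have "\<dots> = (inv f p \<otimes> f q) \<odot>\<^bsub>B\<^esub> h (path_elem K q)"
    by (rule B.smult_assoc1[symmetric]) simp_all
  finally show "h (path_elem K p) = (inv f p \<otimes> f q) \<odot>\<^bsub>B\<^esub> h (path_elem K q)" .
qed

lemma corner_carrier:
  "carrier (corner B a b) = {a \<otimes>\<^bsub>B\<^esub> x \<otimes>\<^bsub>B\<^esub> b | x. x \<in> carrier B}"
  by (simp add: corner_def)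

text \<open>
  The line that contains the images of all paths from \<open>u\<close> to \<open>w\<close>. Zero serves as its
  spanning vector when there is no such path, which spares a case distinction later.
\<close>

lemma representative_exists:
  assumes "u \<in> verts Q" "w \<in> verts Q"
  shows "\<exists>r \<in> carrier (corner B (h (vertex_elem K u)) (h (vertex_elem K w))).
    \<forall>p\<in>qpaths Q. fst p = u \<longrightarrow> snd (snd p) = w \<longrightarrow> (\<exists>c\<in>carrier K. h (path_elem K p) = c \<odot>\<^bsub>B\<^esub> r)"
proof (cases "\<exists>q\<in>qpaths Q. fst q = u \<and> snd (snd q) = w")
  case True
  then obtain q where q: "q \<in> qpaths Q" "fst q = u" "snd (snd q) = w"
    by blast
  then have "h (path_elem K q) \<in> carrier B"
    by (simp add: path_closed)
  then have "h (path_elem K q) \<in> carrier (corner B (h (vertex_elem K u)) (h (vertex_elem K w)))"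
    unfolding corner_carrier using corner_path[OF assms q(1)] q
    by (auto intro!: exI[of _ "h (path_elem K q)"])
  moreover have "\<exists>c\<in>carrier K. h (path_elem K p) = c \<odot>\<^bsub>B\<^esub> h (path_elem K q)"
    if "p \<in> qpaths Q" "fst p = u" "snd (snd p) = w" for p
    using that q by (intro parallel_paths_proportional) (simp_all add: qparallel_def)
  ultimately show ?thesis
    by blast
next
  case False
  have "\<zero>\<^bsub>B\<^esub> \<in> carrier (corner B (h (vertex_elem K u)) (h (vertex_elem K w)))"
    using vertex_closed assms unfolding corner_carrier by (auto intro!: exI[of _ "\<zero>\<^bsub>B\<^esub>"])
  then show ?thesis
    using False by blast
qed

text \<open>
  Sandwiching \<open>h y\<close> between the images of \<open>u\<close> and \<open>w\<close> is linear in \<open>y\<close> and sends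
  every path into the line of its representative, so it sends the whole path algebra there.
\<close>

lemma corner_fin_dim_le:
  assumes "u \<in> verts Q" "w \<in> verts Q"
  shows "fin_dim_le K (corner B (h (vertex_elem K u)) (h (vertex_elem K w))) 1"
proof -
  let ?a = "h (vertex_elem K u)" and ?b = "h (vertex_elem K w)"
  let ?C = "corner B ?a ?b"
  have [simp]: "?a \<in> carrier B" "?b \<in> carrier B"
    using assms vertex_closed by auto
  obtain r where r: "r \<in> carrier ?C"
    and proportional: "\<And>p. \<lbrakk>p \<in> qpaths Q; fst p = u; snd (snd p) = w\<rbrakk> \<Longrightarrow>
      \<exists>c\<in>carrier K. h (path_elem K p) = c \<odot>\<^bsub>B\<^esub> r"
    using representative_exists[OF assms] by blast
  have [simp]: "r \<in> carrier B"
    using r unfolding corner_carrier by auto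
  have line: "\<exists>c\<in>carrier K. ?a \<otimes>\<^bsub>B\<^esub> h y \<otimes>\<^bsub>B\<^esub> ?b = c \<odot>\<^bsub>B\<^esub> r"
    if "y \<in> carrier (path_algebra K Q)" for y
    using K.ring_axioms that
  proof (induction rule: path_algebra_induct)
    case zero
    show ?case
      by (rule bexI[of _ \<zero>]) simp_all
  next
    case (path p)
    show ?case
    proof (cases "fst p = u \<and> snd (snd p) = w")
      case True
      then show ?thesis
        using corner_path[OF assms path] proportional path by simp
    next
      case False
      then show ?thesis
        using corner_path[OF assms path] by (auto intro!: bexI[of _ \<zero>])
    qed
  next
    case (add x y)
    then obtain c d where c: "c \<in> carrier K" "d \<in> carrier K"
      "?a \<otimes>\<^bsub>B\<^esub> h x \<otimes>\<^bsub>B\<^esub> ?b = c \<odot>\<^bsub>B\<^esub> r" "?a \<otimes>\<^bsub>B\<^esub> h y \<otimes>\<^bsub>B\<^esub> ?b = d \<odot>\<^bsub>B\<^esub> r"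
      by blast
    have "?a \<otimes>\<^bsub>B\<^esub> h (x \<oplus>\<^bsub>path_algebra K Q\<^esub> y) \<otimes>\<^bsub>B\<^esub> ?b =
        ?a \<otimes>\<^bsub>B\<^esub> h x \<otimes>\<^bsub>B\<^esub> ?b \<oplus>\<^bsub>B\<^esub> ?a \<otimes>\<^bsub>B\<^esub> h y \<otimes>\<^bsub>B\<^esub> ?b"
      using add by (simp add: B.l_distr B.r_distr)
    also have "\<dots> = (c \<oplus> d) \<odot>\<^bsub>B\<^esub> r"
      using c by (simp add: B.smult_l_distr)
    finally show ?case
      using c by blast
  next
    case (smult c x)
    then obtain d where d: "d \<in> carrier K" "?a \<otimes>\<^bsub>B\<^esub> h x \<otimes>\<^bsub>B\<^esub> ?b = d \<odot>\<^bsub>B\<^esub> r"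
      by blast
    have "?a \<otimes>\<^bsub>B\<^esub> h (c \<odot>\<^bsub>path_algebra K Q\<^esub> x) \<otimes>\<^bsub>B\<^esub> ?b = c \<odot>\<^bsub>B\<^esub> (?a \<otimes>\<^bsub>B\<^esub> h x \<otimes>\<^bsub>B\<^esub> ?b)"
      using smult by (simp add: hom_smult B.smult_mult_left B.smult_mult_right)
    also have "\<dots> = (c \<otimes> d) \<odot>\<^bsub>B\<^esub> r"
      using d smult by (simp add: B.smult_assoc1)
    finally show ?case
      using d smult by blast
  qed
  have vs: "vectorspace K ?C"
    by (intro vectorspace.intro B.corner_is_module K.field_axioms) simp_all
  have smult: "smult ?C = smult B"
    by (simp add: corner_def)
  show ?thesis
  proof (rule fin_dim_leI_line[OF vs r])
    fix x assume "x \<in> carrier ?C"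
    then obtain z where "z \<in> carrier B" and x: "x = ?a \<otimes>\<^bsub>B\<^esub> z \<otimes>\<^bsub>B\<^esub> ?b"
      unfolding corner_carrier by blast
    then have "z \<in> h ` carrier (path_algebra K Q)"
      using surj by simp
    then obtain y where "z = h y" "y \<in> carrier (path_algebra K Q)"
      by (rule imageE)
    then show "\<exists>c\<in>carrier K. x = c \<odot>\<^bsub>?C\<^esub> r"
      unfolding smult x using line by simp
  qed
qed

text \<open>
  The span of the representatives of all pairs of vertices contains the image of every path, hence
  everything. Representatives may coincide or vanish, so this yields only an upper bound.
\<close>

lemma quotient_fin_dim_le: "fin_dim_le K B (card (verts Q) ^ 2)"
proof -
  have "\<forall>u\<in>verts Q. \<forall>w\<in>verts Q. \<exists>r. r \<in> carrier B \<and>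
      (\<forall>p\<in>qpaths Q. fst p = u \<longrightarrow> snd (snd p) = w \<longrightarrow>
        (\<exists>c\<in>carrier K. h (path_elem K p) = c \<odot>\<^bsub>B\<^esub> r))"
  proof (intro ballI)
    fix u w assume uw: "u \<in> verts Q" "w \<in> verts Q"
    have "carrier (corner B (h (vertex_elem K u)) (h (vertex_elem K w))) \<subseteq> carrier B"
      using vertex_closed uw unfolding corner_carrier by auto
    then show "\<exists>r. r \<in> carrier B \<and> (\<forall>p\<in>qpaths Q. fst p = u \<longrightarrow> snd (snd p) = w \<longrightarrow>
        (\<exists>c\<in>carrier K. h (path_elem K p) = c \<odot>\<^bsub>B\<^esub> r))"
      using representative_exists[OF uw] by blast
  qed
  then obtain r where r: "\<And>u w. \<lbrakk>u \<in> verts Q; w \<in> verts Q\<rbrakk> \<Longrightarrow> r u w \<in> carrier B"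
    and proportional: "\<And>p u w. \<lbrakk>u \<in> verts Q; w \<in> verts Q; p \<in> qpaths Q; fst p = u; snd (snd p) = w\<rbrakk> \<Longrightarrow>
      \<exists>c\<in>carrier K. h (path_elem K p) = c \<odot>\<^bsub>B\<^esub> r u w"
    by metis
  define S where "S = (\<lambda>(u, w). r u w) ` (verts Q \<times> verts Q)"
  have S: "S \<subseteq> carrier B"
    using r by (auto simp: S_def)
  interpret span: LinearCombinations.submodule K "B.span S" B
    using B.span_is_submodule[OF S] .
  have "h x \<in> B.span S" if "x \<in> carrier (path_algebra K Q)" for x
    using K.ring_axioms that
  proof (induction rule: path_algebra_induct)
    case (path p)
    have ends: "fst p \<in> verts Q" "snd (snd p) \<in> verts Q"
      using path awalk_hd_in_verts awalk_last_in_verts by (auto simp: qpaths_def)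
    then have "r (fst p) (snd (snd p)) \<in> B.span S"
      using B.in_own_span[OF S] by (auto simp: S_def)
    then show ?case
      using proportional[OF ends path] span.smult_closed by fastforce
  qed (auto simp: hom_smult)
  then have "carrier B \<subseteq> B.span S"
    unfolding surj[symmetric] by (rule image_subsetI)
  moreover have "card S \<le> card (verts Q) ^ 2"
    unfolding S_def using card_image_le[of "verts Q \<times> verts Q" "\<lambda>(u, w). r u w"]
    by (simp add: power2_eq_square)
  moreover have "finite S"
    by (simp add: S_def)
  moreover have "vectorspace K B"
    by (intro vectorspace.intro K.field_axioms B.module_axioms)
  ultimately show ?thesis
    using S by (intro fin_dim_leI_span)
qed

end

section \<open>The quasi-commuting algebra\<close>

text \<open>
  Relations hold in a quotient as soon as the differences of their sides lie in the ideal. Here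
  these differences are the generators of the quasi-commuting ideal.
\<close>

lemma quasi_commuting_algebra_hom:
  assumes "field K" "fin_digraph Q" "ideal I (path_algebra K Q)"
    and "f \<in> qpaths Q \<rightarrow> carrier K - {\<zero>\<^bsub>K\<^esub>}"
  shows "quasi_commuting_hom K Q (quasi_commuting_algebra K Q I f)
    (\<lambda>x. quasi_commuting_ideal K Q I f +>\<^bsub>factor_algebra (path_algebra K Q) I\<^esub>
       (I +>\<^bsub>path_algebra K Q\<^esub> x)) f"
proof -
  let ?A = "path_algebra K Q" and ?C = "quasi_commuting_ideal K Q I f"
  let ?L = "factor_algebra ?A I"
  let ?\<pi> = "\<lambda>x. I +>\<^bsub>?A\<^esub> x"
  interpret K: field K by fact
  interpret I: ideal I ?A by fact
  interpret A: assoc_algebra K ?A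
    using K.is_cring I.ring_axioms by (rule path_algebra_is_assoc_algebra)
  interpret \<pi>: algebra_hom K ?A ?L ?\<pi>
    using assms(3) by (rule A.coset_algebra_hom)
  note [simp del] = factor_algebra_simps
  define G where "G = {(f p \<odot>\<^bsub>?L\<^esub> ?\<pi> (path_elem K p)) \<ominus>\<^bsub>?L\<^esub> (f q \<odot>\<^bsub>?L\<^esub> ?\<pi> (path_elem K q)) | p q.
               p \<in> qpaths Q \<and> q \<in> qpaths Q \<and> qparallel p q}"
  have C: "?C = Idl\<^bsub>?L\<^esub> G"
    unfolding quasi_commuting_ideal_def G_def Let_def ..
  have f: "f p \<in> carrier K - {\<zero>\<^bsub>K\<^esub>}" if "p \<in> qpaths Q" for p
    using assms(4) that by blast
  have term_closed: "f p \<odot>\<^bsub>?L\<^esub> ?\<pi> (path_elem K p) \<in> carrier ?L" if "p \<in> qpaths Q" for p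
    using that f path_elem_closed[OF K.ring_axioms that] by (simp add: Pi_iff)
  have G: "G \<subseteq> carrier ?L"
    using term_closed unfolding G_def by auto
  interpret C: ideal ?C ?L
    unfolding C using G by (rule \<pi>.B.genideal_ideal)
  interpret h: algebra_hom K ?L "factor_algebra ?L ?C" "\<lambda>x. ?C +>\<^bsub>?L\<^esub> x"
    using C.ideal_axioms by (rule \<pi>.B.coset_algebra_hom)
  show ?thesis
    unfolding quasi_commuting_algebra_def
  proof (intro quasi_commuting_hom.intro quasi_commuting_hom_axioms.intro K.field_axioms assms(2)
      algebra_hom_comp[OF \<pi>.algebra_hom_axioms h.algebra_hom_axioms] f)
    show "(\<lambda>x. ?C +>\<^bsub>?L\<^esub> ?\<pi> x) ` carrier ?A = carrier (factor_algebra ?L ?C)"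
      by (auto simp: factor_algebra_simps A_RCOSETS_def')
  next
    fix p q assume pq: "p \<in> qpaths Q" "q \<in> qpaths Q" "qparallel p q"
    let ?p = "f p \<odot>\<^bsub>?L\<^esub> ?\<pi> (path_elem K p)" and ?q = "f q \<odot>\<^bsub>?L\<^esub> ?\<pi> (path_elem K q)"
    have "?p \<ominus>\<^bsub>?L\<^esub> ?q \<in> G"
      using pq unfolding G_def by blast
    then have "?p \<ominus>\<^bsub>?L\<^esub> ?q \<in> ?C"
      unfolding C using \<pi>.B.genideal_self[OF G] by blast
    then have "?C +>\<^bsub>?L\<^esub> ?p = ?C +>\<^bsub>?L\<^esub> ?q"
      using \<pi>.B.quotient_eq_iff_same_a_r_cos[OF C.ideal_axioms] term_closed pq by blast
    moreover have "f s \<odot>\<^bsub>factor_algebra ?L ?C\<^esub> (?C +>\<^bsub>?L\<^esub> ?\<pi> (path_elem K s)) =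
        ?C +>\<^bsub>?L\<^esub> (f s \<odot>\<^bsub>?L\<^esub> ?\<pi> (path_elem K s))" if "s \<in> qpaths Q" for s
      using f[OF that] path_elem_closed[OF K.ring_axioms that]
      by (intro h.hom_smult[symmetric] \<pi>.hom_closed) simp_all
    ultimately show "f p \<odot>\<^bsub>factor_algebra ?L ?C\<^esub> (?C +>\<^bsub>?L\<^esub> ?\<pi> (path_elem K p)) =
        f q \<odot>\<^bsub>factor_algebra ?L ?C\<^esub> (?C +>\<^bsub>?L\<^esub> ?\<pi> (path_elem K q))"
      using pq by simp
  qed
qed

theorem theorem3p1:
  fixes K :: "('k, 'm) ring_scheme"
    and Q :: "('v, 'e) pre_digraph"
    and n :: nat
    and v :: "nat \<Rightarrow> 'v"
    and I :: "(('v, 'e) qpath \<Rightarrow> 'k) set"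
    and f :: "('v, 'e) qpath \<Rightarrow> 'k"
  assumes "field K"
    and "fin_digraph Q"
    and "bij_betw v {1..n} (verts Q)"
    and "ideal I (path_algebra K Q)"
    and "I \<subseteq> Idl\<^bsub>path_algebra K Q\<^esub> {path_elem K p | p. p \<in> qpaths Q \<and> qlength p = 2}"
    and "f \<in> qpaths Q \<rightarrow> carrier K - {\<zero>\<^bsub>K\<^esub>}"
  shows "(\<forall>i\<in>{1..n}. \<forall>j\<in>{1..n}.
            fin_dim_le K (corner (quasi_commuting_algebra K Q I f)
              (vertex_image K Q I f (v i)) (vertex_image K Q I f (v j))) 1)
       \<and> fin_dim_le K (quasi_commuting_algebra K Q I f) (n ^ 2)"
proof -
  interpret quasi_commuting_hom K Q "quasi_commuting_algebra K Q I f"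
    "\<lambda>x. quasi_commuting_ideal K Q I f +>\<^bsub>factor_algebra (path_algebra K Q) I\<^esub>
       (I +>\<^bsub>path_algebra K Q\<^esub> x)" f
    using assms by (intro quasi_commuting_algebra_hom)
  have "card (verts Q) = n"
    using bij_betw_same_card[OF assms(3)] by simp
  moreover have "v i \<in> verts Q" if "i \<in> {1..n}" for i
    using assms(3) that by (rule bij_betwE[THEN bspec])
  ultimately show ?thesis
    using corner_fin_dim_le quotient_fin_dim_le by (simp add: vertex_image_def)
qed

end
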